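(* Let $X_1$ and $X_2$ be infinite dimensional (real) normed linear spaces, let $r_1,r_2>0$ and let $$T=(T_1,T_2):\overline{B}_{1,r_1}\times \overline{B}_{2,r_2}\longrightarrow X_1\times X_2$$ be a compact map such that $$\inf_{\|x\|=r_1,\ \|y\|=r_2}\|T_1(x,y)\|>0\quad\text{and}\quad \inf_{\|x\|=r_1,\ \|y\|=r_2}\|T_2(x,y)\|>0,$$ where the infima are over $x\in X_1$, $y\in X_2$ with the indicated norms. Then there exist four (distinct) couples of real numbers $(\lambda_1,\lambda_2)$ such that for each of them there is an associated point $(x_0,y_0)\in \overline{B}_{1,r_1}\times \overline{B}_{2,r_2}$ with $\|x_0\|=r_1$ and $\|y_0\|=r_2$ satisfying $$x_0=\lambda_1\,T_1(x_0,y_0),\qquad y_0=\lambda_2\,T_2(x_0,y_0).$$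
   Context: For $i\in\{1,2\}$, $\overline{B}_{i,r_i}=\{x\in X_i:\|x\|\le r_i\}$. The norms of all spaces are denoted by $\|\cdot\|$, and $X_1\times X_2$ carries the maximum norm. A compact map is a continuous map with relatively compact image. *)

theory Defs
  imports "HOL-Analysis.Analysis"
begin

definition infinite_dimensional :: "'a::real_vector itself \<Rightarrow> bool" where
  "infinite_dimensional _ \<longleftrightarrow> \<not> (\<exists>B :: 'a set. finite B \<and> span B = UNIV)"

(* The library norm on a product type is the Euclidean combination of the two norms,
   not their maximum. The two are equivalent and induce the product topology, and
   compact_map_on depends on the topology only. The closure is taken in the whole
   codomain type, which need not be complete. *)
definition compact_map_on :: "'a::topological_space set \<Rightarrow> ('a \<Rightarrow> 'b::topological_space) \<Rightarrow> bool" where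
  "compact_map_on S f \<longleftrightarrow> continuous_on S f \<and> compact (closure (f ` S))"

end

(* For signs s1, s2 the map (x, y) \<mapsto> (s1 r1 T1/|T1|, s2 r2 T2/|T2|) is a compact self-map F
   of the product of the two spheres; a fixed point of it gives a couple (l1, l2) with the
   signs (s1, s2), so the four sign patterns give four couples. An approximate fixed point of F comes
   from Brouwer's theorem on a cube of Schauder coefficients s: form the combination of the net points
   (a_i, b_i) with these coefficients and send its two components to the spheres, by normalisation
   if the component is not short, and after a push in a direction outside the finite dimensional span
   otherwise. At a fixed s the combination is close to a point of the image of F, hence its components
   are not short, and only the normalisation was used. Compactness turns
   approximate fixed points into a fixed point. *)

theory Submission
  imports Defs
begin

section \<open>Brouwer's fixed point theorem on cubes of arbitrary dimension\<close>

text \<open>The dimension will be the size of a finite net found inside a proof, so it has to be a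
  number and not a type. The cube therefore sits in the sequence space with its product topology,
  padded by zeros from index \<open>n\<close> on; the form as a \<open>PiE\<close> makes compactness
  an instance of Tychonoff's theorem.\<close>

definition cube :: "nat \<Rightarrow> (nat \<Rightarrow> real) set" where
  "cube n = PiE UNIV (\<lambda>i. if i < n then {0..1} else {0})"

lemma mem_cube_iff: "x \<in> cube n \<longleftrightarrow> (\<forall>i<n. 0 \<le> x i \<and> x i \<le> 1) \<and> (\<forall>i\<ge>n. x i = 0)"
proof -
  have "x \<in> cube n \<longleftrightarrow> (\<forall>i. x i \<in> (if i < n then {0..1} else {0}))"
    unfolding cube_def PiE_UNIV_domain Pi_iff by blast
  also have "\<dots> \<longleftrightarrow> (\<forall>i. (i < n \<longrightarrow> 0 \<le> x i \<and> x i \<le> 1) \<and> (i \<ge> n \<longrightarrow> x i = 0))"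
    by (intro arg_cong[of _ _ All] ext) (auto simp: not_less)
  also have "\<dots> \<longleftrightarrow> (\<forall>i<n. 0 \<le> x i \<and> x i \<le> 1) \<and> (\<forall>i\<ge>n. x i = 0)"
    by blast
  finally show ?thesis .
qed

lemma compact_cube: "compact (cube n)"
proof -
  have "compactin (product_topology (\<lambda>i::nat. euclidean :: real topology) UNIV) (cube n)"
    unfolding cube_def by (subst compactin_PiE) auto
  then show ?thesis
    by (simp add: euclidean_product_topology)
qed

lemma tendsto_fun_iff:
  fixes f :: "'c \<Rightarrow> 'i \<Rightarrow> 'b::topological_space"
  shows "(f \<longlongrightarrow> l) F \<longleftrightarrow> (\<forall>i. ((\<lambda>c. f c i) \<longlongrightarrow> l i) F)"
  using limitin_componentwise[of "\<lambda>i::'i. euclidean :: 'b topology" UNIV f l F]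
  by (simp add: euclidean_product_topology)

text \<open>Kuhn's combinatorial lemma, on ever finer grids, yields a cell in which every coordinate
  \<open>i\<close> has one vertex where \<open>f\<close> does not lower it and one where
  \<open>f\<close> does not raise it. Along a subsequence the cells shrink to a point
  \<open>z\<close>, and continuity turns these inequalities into equality at
  \<open>z\<close>.\<close>

theorem brouwer_nat_cube:
  fixes f :: "(nat \<Rightarrow> real) \<Rightarrow> nat \<Rightarrow> real"
  assumes cont: "continuous_on (cube n) f" and into: "f \<in> cube n \<rightarrow> cube n"
  obtains z where "z \<in> cube n" "f z = z"
proof -
  define pt :: "nat \<Rightarrow> (nat \<Rightarrow> nat) \<Rightarrow> nat \<Rightarrow> real"
    where "pt p x = (\<lambda>i. if i < n then real (x i) / real (Suc p) else 0)" for p x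
  have pt_cube: "pt p x \<in> cube n" if "\<forall>i<n. x i \<le> Suc p" for p x
    using that by (auto simp: mem_cube_iff pt_def divide_simps)
  \<comment> \<open>Label 0 means that \<open>f\<close> does not lower coordinate \<open>i\<close>.
    The condition \<open>x i < Suc p\<close> forces label 1 on the upper face, as Kuhn's lemma
    demands, even at points where \<open>f\<close> keeps this coordinate at 1.\<close>
  define label :: "nat \<Rightarrow> (nat \<Rightarrow> nat) \<Rightarrow> nat \<Rightarrow> nat"
    where "label p x i = (if x i < Suc p \<and> pt p x i \<le> f (pt p x) i then 0 else 1)" for p x i
  define near where "near q r \<longleftrightarrow> (\<forall>j<n. q j \<le> r j \<and> r j \<le> q j + 1)" for q r :: "nat \<Rightarrow> nat"
  define cell where "cell p q \<longleftrightarrow> (\<forall>i<n. q i < Suc p) \<and>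
      (\<forall>i<n. \<exists>r s. near q r \<and> near q s \<and> label p r i \<noteq> label p s i)" for p q
  have "\<exists>q. cell p q" for p
    unfolding cell_def near_def
  proof (rule kuhn_lemma[of "Suc p" n "label p"])
    show "0 < Suc p" by simp
    show "\<forall>x. (\<forall>i<n. x i \<le> Suc p) \<longrightarrow> (\<forall>i<n. label p x i = 0 \<or> label p x i = 1)"
      and "\<forall>x. (\<forall>i<n. x i \<le> Suc p) \<longrightarrow> (\<forall>i<n. x i = Suc p \<longrightarrow> label p x i = 1)"
      by (simp_all add: label_def)
    show "\<forall>x. (\<forall>i<n. x i \<le> Suc p) \<longrightarrow> (\<forall>i<n. x i = 0 \<longrightarrow> label p x i = 0)"
    proof (intro allI impI)
      fix x i assume x: "\<forall>i<n. x i \<le> Suc p" "i < n" "x i = (0::nat)"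
      then have "f (pt p x) \<in> cube n" using pt_cube into by blast
      with x show "label p x i = 0" by (auto simp: label_def mem_cube_iff pt_def)
    qed
  qed (intro exI conjI)
  then obtain q where "\<And>p. cell p (q p)" by metis
  then have q: "\<And>p i. i < n \<Longrightarrow> q p i < Suc p"
    and ex: "\<And>p i. i < n \<Longrightarrow> \<exists>r s. near (q p) r \<and> near (q p) s \<and> label p r i \<noteq> label p s i"
    unfolding cell_def by blast+
  have near_le: "\<forall>j<n. t j \<le> Suc p" if "near (q p) t" for p t
    using that q unfolding near_def by (metis Suc_eq_plus1 Suc_leI le_trans)
  have brackets: "\<exists>r s. near (q p) r \<and> near (q p) s \<and> pt p r i \<le> f (pt p r) i \<and> f (pt p s) i \<le> pt p s i"
    if i: "i < n" for p i
  proof -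
    have below: "pt p r i \<le> f (pt p r) i" if "label p r i = 0" for r
      using that by (auto simp: label_def split: if_splits)
    \<comment> \<open>Label 1 has two causes: \<open>f\<close> lowers the coordinate, or the vertex
      lies on the upper face, where the coordinate is 1 and \<open>f\<close> cannot exceed
      it.\<close>
    have above: "f (pt p s) i \<le> pt p s i"
      if "label p s i \<noteq> 0" and s: "near (q p) s" for s
    proof -
      note le = near_le[OF s]
      then have "f (pt p s) \<in> cube n" using pt_cube into by blast
      then have "f (pt p s) i \<le> 1" using i by (simp add: mem_cube_iff)
      moreover have "pt p s i = 1" if "s i = Suc p" using that i by (simp add: pt_def)
      ultimately show ?thesis using that(1) le i
        by (auto simp: label_def split: if_splits)
    qed
    obtain r s where rs: "near (q p) r" "near (q p) s" "label p r i \<noteq> label p s i"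
      using ex[OF i] by blast
    show ?thesis
    proof (cases "label p r i = 0")
      case True
      then show ?thesis using below[of r] above[of s] rs by auto
    next
      case False
      then have "label p s i = 0" using rs(3) by (auto simp: label_def split: if_splits)
      then show ?thesis using False below[of s] above[of r] rs by blast
    qed
  qed
  have "\<forall>p. pt p (q p) \<in> cube n"
    using pt_cube q by (meson less_imp_le)
  then obtain z \<sigma> where z: "z \<in> cube n" and \<sigma>: "strict_mono \<sigma>"
    and lim: "((\<lambda>p. pt p (q p)) \<circ> \<sigma>) \<longlonglongrightarrow> z"
    using compact_imp_seq_compact[OF compact_cube[of n]] unfolding seq_compact_def by metis
  \<comment> \<open>The vertices supplied by Kuhn's lemma depend on the coordinate, so convergence
    is shown for every selection \<open>t\<close> of vertices: each differs from the lower corner by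
    at most \<open>1 / Suc p\<close> per coordinate, hence has the same limit.\<close>
  have conv: "(\<lambda>k. pt (\<sigma> k) (t (\<sigma> k))) \<longlonglongrightarrow> z" "(\<lambda>k. f (pt (\<sigma> k) (t (\<sigma> k)))) \<longlonglongrightarrow> f z"
    if t: "\<And>p. near (q p) (t p)" for t
  proof -
    show *: "(\<lambda>k. pt (\<sigma> k) (t (\<sigma> k))) \<longlonglongrightarrow> z"
      unfolding tendsto_fun_iff
    proof
      fix j
      have lim_j: "(\<lambda>k. pt (\<sigma> k) (q (\<sigma> k)) j) \<longlonglongrightarrow> z j"
        using lim unfolding tendsto_fun_iff o_def by blast
      have inv: "(\<lambda>k. 1 / real (Suc (\<sigma> k))) \<longlonglongrightarrow> 0"
        using LIMSEQ_subseq_LIMSEQ[OF lim_1_over_n[THEN LIMSEQ_Suc] \<sigma>] by (simp add: o_def)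
      have up: "(\<lambda>k. pt (\<sigma> k) (q (\<sigma> k)) j + 1 / real (Suc (\<sigma> k))) \<longlonglongrightarrow> z j"
        using tendsto_add[OF lim_j inv] by simp
      have bounds: "pt p (q p) j \<le> pt p (t p) j \<and> pt p (t p) j \<le> pt p (q p) j + 1 / real (Suc p)" for p
      proof (cases "j < n")
        case True
        then have "q p j \<le> t p j" "t p j \<le> q p j + 1"
          using t[of p] by (auto simp: near_def)
        then have "real (q p j) \<le> real (t p j)" "real (t p j) \<le> real (q p j) + 1"
          by linarith+
        then show ?thesis using True
          by (simp add: pt_def divide_right_mono flip: add_divide_distrib)
      qed (simp add: pt_def)
      show "(\<lambda>k. pt (\<sigma> k) (t (\<sigma> k)) j) \<longlonglongrightarrow> z j"
        by (rule tendsto_sandwich[OF _ _ lim_j up]) (use bounds in auto)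
    qed
    have "pt p (t p) \<in> cube n" for p
      by (intro pt_cube near_le t)
    then show "(\<lambda>k. f (pt (\<sigma> k) (t (\<sigma> k)))) \<longlonglongrightarrow> f z"
      by (intro continuous_on_tendsto_compose[OF cont * z]) auto
  qed
  have "f z i = z i" for i
  proof (cases "i < n")
    case True
    obtain r where r: "\<And>p. near (q p) (r p)" "\<And>p. pt p (r p) i \<le> f (pt p (r p)) i"
      using brackets[OF True] by metis
    have "z i \<le> f z i"
      using conv[OF r(1)] r(2) unfolding tendsto_fun_iff
      by (intro LIMSEQ_le[of "\<lambda>k. pt (\<sigma> k) (r (\<sigma> k)) i" _ "\<lambda>k. f (pt (\<sigma> k) (r (\<sigma> k))) i"]) auto
    moreover
    obtain s where s: "\<And>p. near (q p) (s p)" "\<And>p. f (pt p (s p)) i \<le> pt p (s p) i"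
      using brackets[OF True] by metis
    have "f z i \<le> z i"
      using conv[OF s(1)] s(2) unfolding tendsto_fun_iff
      by (intro LIMSEQ_le[of "\<lambda>k. f (pt (\<sigma> k) (s (\<sigma> k))) i" _ "\<lambda>k. pt (\<sigma> k) (s (\<sigma> k)) i"]) auto
    ultimately show ?thesis by simp
  next
    case False
    moreover have "f z \<in> cube n" using into z by blast
    ultimately show ?thesis using z by (simp add: mem_cube_iff)
  qed
  then show thesis using z that by blast
qed

section \<open>Schauder approximation on compact sets\<close>

text \<open>A partition of unity subordinate to the \<epsilon>-balls around a finite net: only net
  points closer than \<epsilon> to \<open>p\<close> get positive weight, so their weighted mean is
  closer than \<epsilon> to \<open>p\<close>. The coefficients are kept apart from the mean because
  Brouwer's theorem will be applied to the coefficients.\<close>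

lemma schauder_coefficients:
  fixes K :: "'c::real_normed_vector set"
  assumes "compact K" "\<epsilon> > 0"
  obtains n a c where "\<And>i. i < n \<Longrightarrow> a i \<in> K" "continuous_on K c" "c \<in> K \<rightarrow> cube n"
    "\<And>p. p \<in> K \<Longrightarrow> norm ((\<Sum>i<n. c p i *\<^sub>R a i) - p) < \<epsilon>"
proof -
  obtain A where A: "finite A" "A \<subseteq> K" "K \<subseteq> (\<Union>x\<in>A. ball x \<epsilon>)"
    using seq_compact_imp_totally_bounded[OF compact_imp_seq_compact[OF \<open>compact K\<close>], rule_format, OF \<open>\<epsilon> > 0\<close>]
    by (elim exE conjE) (rule that)
  obtain a and n :: nat where a: "A = a ` {..<n}"
    using finite_imp_nat_seg_image_inj_on[OF \<open>finite A\<close>] by (auto simp: lessThan_def)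
  define w where "w p i = max 0 (\<epsilon> - dist p (a i))" for p i
  define W where "W p = (\<Sum>i<n. w p i)" for p
  define c where "c p = (\<lambda>i. if i < n then w p i / W p else 0)" for p
  have w0: "w p i \<ge> 0" for p i by (simp add: w_def)
  have W0: "W p > 0" if "p \<in> K" for p
  proof -
    have "p \<in> (\<Union>x\<in>A. ball x \<epsilon>)"
      using A(3) that by blast
    then obtain i where "i < n" "dist p (a i) < \<epsilon>"
      unfolding a by (auto simp: dist_commute)
    then have "w p i > 0" by (simp add: w_def)
    then show ?thesis unfolding W_def
      using \<open>i < n\<close> w0 by (intro sum_pos2[of _ i]) auto
  qed
  have c1: "(\<Sum>i<n. c p i) = 1" if "p \<in> K" for p
    using W0[OF that] by (simp add: c_def W_def flip: sum_divide_distrib)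
  have c0: "c p i \<ge> 0" if "p \<in> K" for p i
    using W0[OF that] w0 by (simp add: c_def)
  show thesis
  proof
    show "a i \<in> K" if "i < n" for i using A(2) a that by auto
    show "c \<in> K \<rightarrow> cube n"
    proof
      fix p assume p: "p \<in> K"
      have "c p i \<le> 1" if "i < n" for i
        using member_le_sum[of i "{..<n}" "c p"] c0[OF p] c1[OF p] that by auto
      moreover have "c p i = 0" if "i \<ge> n" for i
        using that by (simp add: c_def)
      ultimately show "c p \<in> cube n"
        using c0[OF p] by (simp add: mem_cube_iff)
    qed
    have "continuous_on K (\<lambda>p. c p i)" for i
      unfolding c_def w_def W_def
      using W0 by (cases "i < n")
        (auto intro!: continuous_intros simp: W_def w_def less_imp_neq[symmetric])
    then show "continuous_on K c"
      by (rule continuous_on_coordinatewise_then_product)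
    fix p assume p: "p \<in> K"
    \<comment> \<open>The coefficients sum to 1, so \<open>p\<close> can be moved under the
      sum.\<close>
    have "(\<Sum>i<n. c p i *\<^sub>R a i) - p = (\<Sum>i<n. c p i *\<^sub>R (a i - p))"
      using c1[OF p] by (simp add: scaleR_diff_right sum_subtractf flip: scaleR_left.sum)
    also have "norm \<dots> \<le> (\<Sum>i<n. c p i * norm (a i - p))"
      by (rule sum_norm_le) (use c0[OF p] in auto)
    also have "\<dots> < (\<Sum>i<n. c p i * \<epsilon>)"
    \<comment> \<open>Terms of weight zero give equality only; strictness comes from a term of
      nonzero weight, which exists because the weights sum to 1.\<close>
    proof (rule sum_strict_mono_ex1)
      have far: "c p i = 0" if "\<not> norm (a i - p) < \<epsilon>" for i
        using that by (auto simp: c_def w_def dist_norm norm_minus_commute)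
      then show "\<forall>i\<in>{..<n}. c p i * norm (a i - p) \<le> c p i * \<epsilon>"
        using c0[OF p] by (metis less_imp_le mult_left_mono mult_zero_left order_refl)
      have "\<exists>i\<in>{..<n}. c p i \<noteq> 0"
        using c1[OF p] by (metis sum.neutral zero_neq_one)
      then show "\<exists>i\<in>{..<n}. c p i * norm (a i - p) < c p i * \<epsilon>"
        using far c0[OF p] by (metis less_eq_real_def mult_strict_left_mono)
    qed simp
    also have "\<dots> = \<epsilon>"
      using c1[OF p] by (simp flip: sum_distrib_right)
    finally show "norm ((\<Sum>i<n. c p i *\<^sub>R a i) - p) < \<epsilon>" .
  qed
qed

section \<open>Normalisation onto spheres\<close>

text \<open>This is where infinite dimension enters: a finite set cannot span the space, which
  leaves a direction \<open>e\<close> for extending radial normalisation continuously across the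
  origin of the span. The threshold \<open>r / 2\<close> leaves room for the approximation error
  around vectors of norm \<open>r\<close>.\<close>

lemma finite_span_to_sphere:
  fixes A :: "'a::real_normed_vector set"
  assumes "infinite_dimensional TYPE('a)" "finite A" "r > 0"
  obtains h where "continuous_on (span A) h" "h \<in> span A \<rightarrow> sphere 0 r"
    "\<And>u. u \<in> span A \<Longrightarrow> norm u \<ge> r / 2 \<Longrightarrow> h u = (r / norm u) *\<^sub>R u"
proof -
  obtain e where e: "e \<notin> span A"
    using assms(1,2) unfolding infinite_dimensional_def by blast
  \<comment> \<open>pushing short vectors along \<open>e\<close> avoids the origin, so the result can be normalised\<close>
  define g where "g u = u + max 0 (r / 2 - norm u) *\<^sub>R e" for u
  have g0: "g u \<noteq> 0" if u: "u \<in> span A" for u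
  proof
    assume "g u = 0"
    then have eq: "max 0 (r / 2 - norm u) *\<^sub>R e = - u" by (simp add: g_def add_eq_0_iff)
    show False
    proof (cases "r / 2 \<le> norm u")
      case True
      then show False using eq \<open>r > 0\<close> by auto
    next
      case False
      then have "e = (1 / (r / 2 - norm u)) *\<^sub>R (- u)" unfolding eq[symmetric] by simp
      then have "e \<in> span A" using u by (metis span_neg span_scale)
      then show False using e by simp
    qed
  qed
  show thesis
  proof
    show "continuous_on (span A) (\<lambda>u. (r / norm (g u)) *\<^sub>R g u)"
      using g0 unfolding g_def by (intro continuous_intros) auto
    show "(\<lambda>u. (r / norm (g u)) *\<^sub>R g u) \<in> span A \<rightarrow> sphere 0 r"
      using g0 \<open>r > 0\<close> by auto
    show "(r / norm (g u)) *\<^sub>R g u = (r / norm u) *\<^sub>R u" if "norm u \<ge> r / 2" for u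
      using that by (simp add: g_def)
  qed
qed

text \<open>Normalising moves \<open>u\<close> by the gap between \<open>norm u\<close> and
  \<open>norm p\<close>, which is at most \<open>norm (u - p)\<close>; the triangle inequality adds
  the same amount once more.\<close>

lemma dist_normalize_le:
  fixes u p :: "'a::real_normed_vector"
  assumes "u \<noteq> 0" "norm p = r"
  shows "dist ((r / norm u) *\<^sub>R u) p \<le> 2 * norm (u - p)"
proof -
  have "(r / norm u) *\<^sub>R u - u = ((r - norm u) / norm u) *\<^sub>R u"
    using \<open>u \<noteq> 0\<close> by (simp add: diff_divide_distrib scaleR_diff_left)
  then have "norm ((r / norm u) *\<^sub>R u - u) = \<bar>norm p - norm u\<bar>"
    using assms by simp
  also have "\<dots> \<le> norm (u - p)"
    by (metis norm_minus_commute norm_triangle_ineq3)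
  finally show ?thesis
    using norm_triangle_ineq[of "(r / norm u) *\<^sub>R u - u" "u - p"] by (simp add: dist_norm)
qed

section \<open>Fixed points of compact self-maps of a product of two spheres\<close>

text \<open>The domain is not convex, so the finite dimensional problem is posed on the cube of
  coefficients instead. Taking the compact set \<open>K\<close> inside the product of spheres keeps
  the final limit in the domain of the map.\<close>

theorem sphere_product_fixpoint:
  fixes F1 :: "'a::real_normed_vector \<times> 'b::real_normed_vector \<Rightarrow> 'a" and F2 :: "'a \<times> 'b \<Rightarrow> 'b"
  assumes inf: "infinite_dimensional TYPE('a)" "infinite_dimensional TYPE('b)"
    and pos: "r1 > 0" "r2 > 0"
    and cont: "continuous_on (sphere 0 r1 \<times> sphere 0 r2) (\<lambda>z. (F1 z, F2 z))"
    and K: "compact K" "K \<subseteq> sphere 0 r1 \<times> sphere 0 r2"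
    and into: "(\<lambda>z. (F1 z, F2 z)) \<in> sphere 0 r1 \<times> sphere 0 r2 \<rightarrow> K"
  obtains x y where "norm x = r1" "norm y = r2" "F1 (x, y) = x" "F2 (x, y) = y"
proof -
  let ?S = "sphere 0 r1 \<times> sphere 0 r2 :: ('a \<times> 'b) set"
  define F where "F z = (F1 z, F2 z)" for z
  have contF: "continuous_on ?S F" and FK: "\<And>z. z \<in> ?S \<Longrightarrow> F z \<in> K"
    using cont into by (auto simp: F_def[abs_def])
  have approx: "\<exists>z\<in>?S. dist (fst z) (fst (F z)) \<le> \<epsilon> \<and> dist (snd z) (snd (F z)) \<le> \<epsilon>"
    if "\<epsilon> > 0" for \<epsilon>
  proof -
    \<comment> \<open>The bound \<open>\<epsilon> / 2\<close> pays for the factor 2 of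
      normalisation; the bounds \<open>r1 / 2\<close> and \<open>r2 / 2\<close> keep the components
      of the approximant long enough for \<open>h1\<close> and \<open>h2\<close> to be plain
      normalisation.\<close>
    define \<delta> where "\<delta> = Min {\<epsilon> / 2, r1 / 2, r2 / 2}"
    have \<delta>: "\<delta> > 0" "\<delta> \<le> \<epsilon> / 2" "\<delta> \<le> r1 / 2" "\<delta> \<le> r2 / 2"
      using that pos by (auto simp: \<delta>_def)
    obtain n a c where cc: "continuous_on K c" "c \<in> K \<rightarrow> cube n"
      and near: "\<And>p. p \<in> K \<Longrightarrow> norm ((\<Sum>i<n. c p i *\<^sub>R a i) - p) < \<delta>"
      by (rule schauder_coefficients[OF K(1) \<delta>(1)]) (rule that)
    define U where "U s = (\<Sum>i<n. s i *\<^sub>R a i)" for s :: "nat \<Rightarrow> real"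
    have fstU: "fst (U s) = (\<Sum>i<n. s i *\<^sub>R fst (a i))" and sndU: "snd (U s) = (\<Sum>i<n. s i *\<^sub>R snd (a i))" for s
      by (simp_all add: U_def fst_sum snd_sum)
    have contU: "continuous_on X U" for X
      unfolding U_def by (intro continuous_intros continuous_on_product_then_coordinatewise continuous_on_id)
    let ?A1 = "(\<lambda>i. fst (a i)) ` {..<n}" and ?A2 = "(\<lambda>i. snd (a i)) ` {..<n}"
    have span1: "fst (U s) \<in> span ?A1" for s
      unfolding fstU by (intro span_sum span_scale span_base imageI)
    have span2: "snd (U s) \<in> span ?A2" for s
      unfolding sndU by (intro span_sum span_scale span_base imageI)
    obtain h1 where h1: "continuous_on (span ?A1) h1" "h1 \<in> span ?A1 \<rightarrow> sphere 0 r1"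
      "\<And>u. u \<in> span ?A1 \<Longrightarrow> norm u \<ge> r1 / 2 \<Longrightarrow> h1 u = (r1 / norm u) *\<^sub>R u"
      using finite_span_to_sphere[OF inf(1) _ pos(1), of ?A1] by auto
    obtain h2 where h2: "continuous_on (span ?A2) h2" "h2 \<in> span ?A2 \<rightarrow> sphere 0 r2"
      "\<And>u. u \<in> span ?A2 \<Longrightarrow> norm u \<ge> r2 / 2 \<Longrightarrow> h2 u = (r2 / norm u) *\<^sub>R u"
      using finite_span_to_sphere[OF inf(2) _ pos(2), of ?A2] by auto
    define \<phi> where "\<phi> s = (h1 (fst (U s)), h2 (snd (U s)))" for s
    have \<phi>S: "\<phi> s \<in> ?S" for s
      using h1(2) h2(2) span1 span2 unfolding \<phi>_def by blast
    have cont\<phi>: "continuous_on X \<phi>" for X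
      unfolding \<phi>_def
      by (intro continuous_on_Pair continuous_on_compose2[OF h1(1)] continuous_on_compose2[OF h2(1)]
            continuous_on_fst continuous_on_snd contU) (use span1 span2 in auto)
    \<comment> \<open>The self-map of the cube goes from coefficients by \<open>\<phi>\<close> to
      the spheres, by \<open>F\<close> into \<open>K\<close>, and by \<open>c\<close> back to
      coefficients.\<close>
    have contG: "continuous_on (cube n) (\<lambda>s. c (F (\<phi> s)))"
      by (intro continuous_on_compose2[OF cc(1)] continuous_on_compose2[OF contF] cont\<phi>)
        (use \<phi>S FK in blast)+
    have intoG: "(\<lambda>s. c (F (\<phi> s))) \<in> cube n \<rightarrow> cube n"
      using cc(2) \<phi>S FK by blast
    obtain s where s: "c (F (\<phi> s)) = s"
      using brouwer_nat_cube[OF contG intoG] by metis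
    define p where "p = F (\<phi> s)"
    have p: "p \<in> K" unfolding p_def by (rule FK[OF \<phi>S])
    then have n1: "norm (fst p) = r1" and n2: "norm (snd p) = r2" using K(2) by auto
    \<comment> \<open>At the fixed point, \<open>s\<close> is the coefficient vector of
      \<open>p\<close> itself, so \<open>U s\<close> is the Schauder approximant of
      \<open>p\<close>.\<close>
    have Up: "norm (U s - p) < \<delta>"
      using near[OF p] s by (simp add: U_def p_def)
    have Up1: "norm (fst (U s) - fst p) < \<delta>" and Up2: "norm (snd (U s) - snd p) < \<delta>"
      using le_less_trans[OF norm_fst_le[of "fst (U s - p)" "snd (U s - p)", unfolded prod.collapse] Up]
        le_less_trans[OF norm_snd_le[of "snd (U s - p)" "fst (U s - p)", unfolded prod.collapse] Up]
      by simp_all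
    have U1: "norm (fst (U s)) \<ge> r1 / 2"
      using norm_triangle_ineq2[of "fst p" "fst (U s)"] Up1 n1 \<delta>(3) by (simp add: norm_minus_commute)
    have U2: "norm (snd (U s)) \<ge> r2 / 2"
      using norm_triangle_ineq2[of "snd p" "snd (U s)"] Up2 n2 \<delta>(4) by (simp add: norm_minus_commute)
    have nz: "fst (U s) \<noteq> 0" "snd (U s) \<noteq> 0"
      using U1 U2 pos by auto
    have "dist (fst (\<phi> s)) (fst p) \<le> 2 * norm (fst (U s) - fst p)"
      using h1(3)[OF span1 U1] dist_normalize_le[OF nz(1) n1] by (simp add: \<phi>_def)
    moreover have "dist (snd (\<phi> s)) (snd p) \<le> 2 * norm (snd (U s) - snd p)"
      using h2(3)[OF span2 U2] dist_normalize_le[OF nz(2) n2] by (simp add: \<phi>_def)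
    ultimately have "dist (fst (\<phi> s)) (fst p) \<le> \<epsilon>" "dist (snd (\<phi> s)) (snd p) \<le> \<epsilon>"
      using Up1 Up2 \<delta>(2) by linarith+
    then show ?thesis using \<phi>S unfolding p_def by blast
  qed
  have "\<exists>z. z \<in> ?S \<and> dist (fst z) (fst (F z)) \<le> inverse (Suc k) \<and> dist (snd z) (snd (F z)) \<le> inverse (Suc k)" for k
  proof -
    have "inverse (real (Suc k)) > 0" by simp
    from approx[OF this] show ?thesis by blast
  qed
  then obtain z where z: "\<And>k. z k \<in> ?S"
    and z1: "\<And>k. dist (fst (z k)) (fst (F (z k))) \<le> inverse (Suc k)"
    and z2: "\<And>k. dist (snd (z k)) (snd (F (z k))) \<le> inverse (Suc k)"
    by metis
  \<comment> \<open>The spheres are not compact, so the subsequence is extracted from the images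
    \<open>F (z k)\<close> in \<open>K\<close>; the points \<open>z k\<close> inherit the limit
    because the differences tend to 0.\<close>
  obtain l \<sigma> where l: "l \<in> K" "strict_mono \<sigma>" and lim: "((\<lambda>k. F (z k)) \<circ> \<sigma>) \<longlonglongrightarrow> l"
    using K(1) FK z unfolding compact_def by metis
  have diff: "(\<lambda>k. z k - F (z k)) \<longlonglongrightarrow> 0"
  proof -
    have "(\<lambda>k. fst (z k) - fst (F (z k))) \<longlonglongrightarrow> 0" "(\<lambda>k. snd (z k) - snd (F (z k))) \<longlonglongrightarrow> 0"
      using z1 z2 by (auto intro!: Lim_null_comparison[OF _ LIMSEQ_inverse_real_of_nat] simp: dist_norm)
    from tendsto_Pair[OF this] show ?thesis
      by (simp add: zero_prod_def minus_prod_def)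
  qed
  have zl: "(\<lambda>k. z (\<sigma> k)) \<longlonglongrightarrow> l"
    using tendsto_add[OF LIMSEQ_subseq_LIMSEQ[OF diff l(2)] lim] by (simp add: o_def)
  have lS: "l \<in> ?S" using l(1) K(2) by blast
  have "(\<lambda>k. F (z (\<sigma> k))) \<longlonglongrightarrow> F l"
    by (intro continuous_on_tendsto_compose[OF contF zl lS] always_eventually allI z)
  then have "F l = l"
    using lim LIMSEQ_unique by (auto simp: o_def)
  then show thesis
    using that[of "fst l" "snd l"] lS by (auto simp: F_def prod_eq_iff)
qed

section \<open>Couples with prescribed signs\<close>

text \<open>A fixed point of the map that rescales each component of \<open>T\<close> to length
  \<open>r1\<close> or \<open>r2\<close>, with sign \<open>\<sigma>1\<close> or
  \<open>\<sigma>2\<close>, solves both equations; the rescaling factors are the numbers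
  \<open>l1\<close> and \<open>l2\<close>, and their signs are the chosen ones.\<close>

lemma compact_map_sphere_eigenpair:
  fixes T1 :: "'a::real_normed_vector \<times> 'b::real_normed_vector \<Rightarrow> 'a" and T2 :: "'a \<times> 'b \<Rightarrow> 'b"
  assumes inf: "infinite_dimensional TYPE('a)" "infinite_dimensional TYPE('b)"
    and pos: "r1 > 0" "r2 > 0"
    and T: "compact_map_on (sphere 0 r1 \<times> sphere 0 r2) (\<lambda>z. (T1 z, T2 z))"
    and \<delta>: "\<delta>1 > 0" "\<delta>2 > 0"
    and lower: "\<And>z. z \<in> sphere 0 r1 \<times> sphere 0 r2 \<Longrightarrow> \<delta>1 \<le> norm (T1 z)"
      "\<And>z. z \<in> sphere 0 r1 \<times> sphere 0 r2 \<Longrightarrow> \<delta>2 \<le> norm (T2 z)"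
    and \<sigma>: "\<bar>\<sigma>1\<bar> = 1" "\<bar>\<sigma>2\<bar> = 1"
  obtains l1 l2 x y where "norm x = r1" "norm y = r2" "sgn l1 = \<sigma>1" "sgn l2 = \<sigma>2"
    "x = l1 *\<^sub>R T1 (x, y)" "y = l2 *\<^sub>R T2 (x, y)"
proof -
  let ?S = "sphere 0 r1 \<times> sphere 0 r2 :: ('a \<times> 'b) set"
  define T where "T z = (T1 z, T2 z)" for z
  define C where "C = closure (T ` ?S)"
  have contT: "continuous_on ?S T" and C: "compact C"
    using T by (auto simp: compact_map_on_def T_def[abs_def] C_def)
  have "closed {w :: 'a \<times> 'b. \<delta>1 \<le> norm (fst w) \<and> \<delta>2 \<le> norm (snd w)}"
    by (intro closed_Collect_conj closed_Collect_le continuous_intros)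
  then have Clower: "C \<subseteq> {w. \<delta>1 \<le> norm (fst w) \<and> \<delta>2 \<le> norm (snd w)}"
    unfolding C_def using lower by (intro closure_minimal) (auto simp: T_def)
  define N where "N w = ((\<sigma>1 * r1 / norm (fst w)) *\<^sub>R fst w, (\<sigma>2 * r2 / norm (snd w)) *\<^sub>R snd w)" for w :: "'a \<times> 'b"
  have C0: "fst w \<noteq> 0" "snd w \<noteq> 0" if "w \<in> C" for w
    using Clower that \<delta> by fastforce+
  have contN: "continuous_on C N"
    unfolding N_def using C0 by (intro continuous_intros) auto
  have NS: "N ` C \<subseteq> ?S"
    using C0 pos \<sigma> by (auto simp: N_def abs_mult)
  have TC: "T z \<in> C" if "z \<in> ?S" for z
    unfolding C_def using that by (intro subsetD[OF closure_subset] imageI)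
  have contNT: "continuous_on ?S (\<lambda>z. N (T z))"
    by (rule continuous_on_compose2[OF contN contT]) (use TC in blast)
  have intoNT: "(\<lambda>z. N (T z)) \<in> ?S \<rightarrow> N ` C"
    using TC by blast
  obtain x y where xy: "norm x = r1" "norm y = r2" "fst (N (T (x, y))) = x" "snd (N (T (x, y))) = y"
    by (rule sphere_product_fixpoint[OF inf pos _ compact_continuous_image[OF contN C] NS,
          of "\<lambda>z. fst (N (T z))" "\<lambda>z. snd (N (T z))"]) (use contNT intoNT in auto)
  have "T (x, y) \<in> C" using TC xy by simp
  from C0[OF this] have nz: "norm (T1 (x, y)) > 0" "norm (T2 (x, y)) > 0" by (auto simp: T_def)
  have sgn: "sgn \<sigma>1 = \<sigma>1" "sgn \<sigma>2 = \<sigma>2"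
    using \<sigma> by (auto simp: sgn_if abs_if split: if_splits)
  show thesis
  proof
    show "norm x = r1" "norm y = r2" by fact+
    show "sgn (\<sigma>1 * r1 / norm (T1 (x, y))) = \<sigma>1" "sgn (\<sigma>2 * r2 / norm (T2 (x, y))) = \<sigma>2"
      using nz pos sgn by (simp_all add: sgn_mult sgn_divide)
    show "x = (\<sigma>1 * r1 / norm (T1 (x, y))) *\<^sub>R T1 (x, y)" "y = (\<sigma>2 * r2 / norm (T2 (x, y))) *\<^sub>R T2 (x, y)"
      using xy by (simp_all add: N_def T_def)
  qed
qed

section \<open>Four couples from the four sign patterns\<close>

lemma compact_map_on_subset:
  assumes "compact_map_on S f" "S' \<subseteq> S"
  shows "compact_map_on S' f"
proof -
  have "closure (f ` S) \<inter> closure (f ` S') = closure (f ` S')"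
    using closure_mono[OF image_mono[OF assms(2)], of f] by (rule inf.absorb2)
  then have "compact (closure (f ` S'))"
    using compact_Int_closed[OF _ closed_closure, of "closure (f ` S)" "f ` S'"] assms(1)
    by (simp add: compact_map_on_def)
  then show ?thesis
    using assms continuous_on_subset by (auto simp: compact_map_on_def)
qed

theorem mainTheorem3:
  fixes T1 :: "'a::real_normed_vector \<times> 'b::real_normed_vector \<Rightarrow> 'a"
    and T2 :: "'a \<times> 'b \<Rightarrow> 'b"
    and r1 r2 :: real
  assumes "infinite_dimensional TYPE('a)"
    and "infinite_dimensional TYPE('b)"
    and "r1 > 0" and "r2 > 0"
    and "compact_map_on (cball 0 r1 \<times> cball 0 r2) (\<lambda>z. (T1 z, T2 z))"
    and "(INF z \<in> sphere 0 r1 \<times> sphere 0 r2. norm (T1 z)) > 0"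
    and "(INF z \<in> sphere 0 r1 \<times> sphere 0 r2. norm (T2 z)) > 0"
  shows "\<exists>\<Lambda> :: (real \<times> real) set. card \<Lambda> = 4 \<and>
    (\<forall>(l1, l2) \<in> \<Lambda>. \<exists>x0 y0. (x0, y0) \<in> cball 0 r1 \<times> cball 0 r2 \<and>
       norm x0 = r1 \<and> norm y0 = r2 \<and>
       x0 = l1 *\<^sub>R T1 (x0, y0) \<and> y0 = l2 *\<^sub>R T2 (x0, y0))"
proof -
  let ?S = "sphere 0 r1 \<times> sphere 0 r2 :: ('a \<times> 'b) set"
  let ?B = "cball 0 r1 \<times> cball 0 r2 :: ('a \<times> 'b) set"
  have sub: "?S \<subseteq> ?B" by auto
  have T: "compact_map_on ?S (\<lambda>z. (T1 z, T2 z))"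
    by (rule compact_map_on_subset[OF assms(5) sub])
  \<comment> \<open>The infima themselves serve as the positive lower bounds; norms are bounded
    below by 0, so each infimum is a genuine lower bound.\<close>
  have lower: "(INF z \<in> ?S. norm (T1 z)) \<le> norm (T1 z)" "(INF z \<in> ?S. norm (T2 z)) \<le> norm (T2 z)"
    if "z \<in> ?S" for z
    using that by (auto intro!: cINF_lower bdd_belowI2[of _ 0])
  define good where "good l1 l2 \<longleftrightarrow> (\<exists>x0 y0. (x0, y0) \<in> ?B \<and> norm x0 = r1 \<and> norm y0 = r2 \<and>
       x0 = l1 *\<^sub>R T1 (x0, y0) \<and> y0 = l2 *\<^sub>R T2 (x0, y0))" for l1 l2
  define Sg :: "(real \<times> real) set" where "Sg = {1, -1} \<times> {1, -1}"
  have "\<exists>l. (sgn (fst l), sgn (snd l)) = s \<and> good (fst l) (snd l)" if "s \<in> Sg" for s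
  proof -
    have "\<bar>fst s\<bar> = 1" "\<bar>snd s\<bar> = 1" using that by (auto simp: Sg_def)
    then obtain l1 l2 x y where "norm x = r1" "norm y = r2" "sgn l1 = fst s" "sgn l2 = snd s"
      "x = l1 *\<^sub>R T1 (x, y)" "y = l2 *\<^sub>R T2 (x, y)"
      using compact_map_sphere_eigenpair[OF assms(1-4) T assms(6,7) lower] by metis
    then show ?thesis unfolding good_def
      by (intro exI[of _ "(l1, l2)"] conjI exI[of _ x] exI[of _ y]) auto
  qed
  then obtain L where L: "\<And>s. s \<in> Sg \<Longrightarrow> (sgn (fst (L s)), sgn (snd (L s))) = s"
    "\<And>s. s \<in> Sg \<Longrightarrow> good (fst (L s)) (snd (L s))"
    by metis
  \<comment> \<open>The signs of a couple recover the pattern it was chosen for, so different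
    patterns give different couples.\<close>
  have "inj_on L Sg" using L(1) by (metis inj_onI)
  then have "card (L ` Sg) = 4" by (simp add: card_image Sg_def card_cartesian_product)
  moreover have "\<forall>(l1, l2) \<in> L ` Sg. good l1 l2" using L(2) by (auto simp: case_prod_unfold)
  ultimately show ?thesis unfolding good_def by blast
qed

end
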